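(* Let $\beta\in(0,1)$, $k\in\mathbb{N}$ ($k\ge1$) and $t>0$. Let $U^{2k}(s)$, $s>0$, be the pseudoprocess of order $2k$ governed by $$\frac{\partial}{\partial s}u_{2k}(x,s)=(-1)^{k+1}\frac{\partial^{2k}}{\partial x^{2k}}u_{2k}(x,s),\qquad x\in\mathbb{R},$$ let $U_j^{2k}(1)$, $j\ge 0$, be independent pseudo random variables with the law of $U^{2k}(1)$, and let $N$ be a homogeneous Poisson process with rate $\lambda=1/\Gamma(1-\beta)$. For $\gamma>0$ let $Q_j^{\gamma,2k\beta}$, $j\ge0$, be i.i.d. random variables with $\Pr\{Q_j^{\gamma,2k\beta}>w\}=1$ for $w<\gamma$ and $=(\gamma/w)^{2k\beta}$ for $w>\gamma$. All these variables are independent of each other. Then $$\lim_{\gamma\to0}\ \sum_{j=0}^{N(t\gamma^{-2k\beta})}U_j^{2k}(1)\,Q_j^{\gamma,2k\beta}\ \stackrel{\text{law}}{=}\ U^{2k}\big(H^\beta(t)\big),$$ where $H^\beta$ is a stable subordinator of order $\beta$ independent of $U^{2k}$.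
   Context: Pseudo random variables and pseudoprocesses have signed laws of total mass one, and expectations $\mathbb{E}e^{i\xi\,\cdot}$ are understood with respect to these signed laws through Fourier transforms. The pseudoprocess $U^{2k}$ has at time $s$ the signed density $u_{2k}(x,s)$, the fundamental solution ($u_{2k}(x,0)=\delta(x)$) of the displayed equation, i.e. $\int_{\mathbb{R}}e^{i\xi x}u_{2k}(x,s)\,dx=e^{-s|\xi|^{2k}}$. Independence of pseudo random variables means that the Fourier transform of the law of a sum is the product of the Fourier transforms. For a genuine random variable $Q$ independent of $U^{2k}(1)$, $\mathbb{E}e^{i\xi U^{2k}(1)Q}=\mathbb{E}\big[e^{-|\xi Q|^{2k}}\big]$; the Fourier transform of a random sum is likewise computed by conditioning on the genuine random variables ($N$, $Q_j$). The stable subordinator $H^\beta(t)$ has density $h_\beta(s,t)$, $s\ge0$, with $\int_0^\infty e^{-\mu s}h_\beta(s,t)\,ds=e^{-t\mu^\beta}$, $\mu\ge0$. The law of $U^{2k}(H^\beta(t))$ is the signed density $\int_0^\infty u_{2k}(x,s)h_\beta(s,t)\,ds$, with Fourier transform $\int_0^\infty e^{-s\xi^{2k}}h_\beta(s,t)\,ds$. The limit in law means pointwise convergence of Fourier transforms for every $\xi\in\mathbb{R}$. *)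

theory Defs
  imports "HOL-Probability.Probability"
begin

section \<open>The signed densities of the pseudoprocess\<close>

definition fourier :: "(real \<Rightarrow> real) \<Rightarrow> real \<Rightarrow> complex" where
  "fourier f \<xi> = (LINT x|lborel. complex_of_real (f x) * iexp (\<xi> * x))"

text \<open>
  The signed density \<open>u x s\<close> of the pseudoprocess of order \<open>2 k\<close> at time \<open>s > 0\<close>.  The equation
  with initial datum \<open>\<delta>\<close> alone does not determine \<open>u\<close> (no growth condition is imposed); the last
  clause, the Fourier transform, singles out the fundamental solution.  Nothing is said about
  \<open>u x s\<close> for \<open>s \<le> 0\<close>.
\<close>

definition fundamental_solution :: "nat \<Rightarrow> (real \<Rightarrow> real \<Rightarrow> real) \<Rightarrow> bool" where
  "fundamental_solution k u \<longleftrightarrow>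
     (\<forall>s>0. \<forall>x. \<forall>n<2 * k. (deriv ^^ n) (\<lambda>y. u y s) differentiable (at x)) \<and>
     (\<forall>s>0. \<forall>x. ((\<lambda>r. u x r) has_real_derivative
         (-1) ^ (k + 1) * (deriv ^^ (2 * k)) (\<lambda>y. u y s) x) (at s)) \<and>
     (\<forall>s>0. integrable lborel (\<lambda>x. u x s)) \<and>
     (\<forall>\<phi>::real \<Rightarrow> real. continuous_on UNIV \<phi> \<and> bounded (range \<phi>) \<longrightarrow>
         ((\<lambda>s. LINT x|lborel. \<phi> x * u x s) \<longlongrightarrow> \<phi> 0) (at_right 0)) \<and>
     (\<forall>s>0. \<forall>\<xi>. fourier (\<lambda>x. u x s) \<xi> = complex_of_real (exp (- s * \<bar>\<xi>\<bar> ^ (2 * k))))"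


section \<open>Pseudo random variables\<close>

text \<open>
  A signed law of total mass one on an abstract space is given by a reference measure \<open>M\<close> and a
  signed density \<open>w\<close>; expectations are integrals against \<open>w\<close>.
\<close>

definition pseudo_prob_space :: "'b measure \<Rightarrow> ('b \<Rightarrow> real) \<Rightarrow> bool" where
  "pseudo_prob_space M w \<longleftrightarrow> integrable M w \<and> (LINT \<eta>|M. w \<eta>) = 1"

definition has_signed_density ::
    "'b measure \<Rightarrow> ('b \<Rightarrow> real) \<Rightarrow> ('b \<Rightarrow> real) \<Rightarrow> (real \<Rightarrow> real) \<Rightarrow> bool" where
  "has_signed_density M w X f \<longleftrightarrow>
     X \<in> borel_measurable M \<and> integrable lborel f \<and>
     (\<forall>A\<in>sets borel. (LINT \<eta>|M. w \<eta> * indicator A (X \<eta>)) = (LINT x:A|lborel. f x))"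

definition pseudo_char ::
    "'b measure \<Rightarrow> ('b \<Rightarrow> real) \<Rightarrow> ('b \<Rightarrow> real) \<Rightarrow> real \<Rightarrow> complex" where
  "pseudo_char M w X \<xi> = (LINT \<eta>|M. complex_of_real (w \<eta>) * iexp (\<xi> * X \<eta>))"

text \<open>
  Independence: the Fourier transform of the law of a sum is the product of the Fourier transforms.
  The coefficients \<open>c\<close> express that multiples of independent variables are again independent;
  sums over part of \<open>I\<close> are included by letting coefficients vanish.
\<close>

definition pseudo_indep ::
    "'b measure \<Rightarrow> ('b \<Rightarrow> real) \<Rightarrow> ('i \<Rightarrow> 'b \<Rightarrow> real) \<Rightarrow> 'i set \<Rightarrow> bool" where
  "pseudo_indep M w X I \<longleftrightarrow>
     (\<forall>c \<xi>. pseudo_char M w (\<lambda>\<eta>. \<Sum>i\<in>I. c i * X i \<eta>) \<xi> =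
       (\<Prod>i\<in>I. pseudo_char M w (\<lambda>\<eta>. c i * X i \<eta>) \<xi>))"

text \<open>
  A sequence of independent pseudo random variables \<open>U\<^sub>0, U\<^sub>1, \<dots>\<close> with signed density \<open>f\<close>.
  If \<open>f\<close> takes negative values, the total variation of the \<open>n\<close>-fold product law grows
  geometrically, so the whole sequence does not live on one space with a finite signed law.
  Hence \<open>U\<^sub>0, \<dots>, U\<^sub>n\<close> live on a space depending on \<open>n\<close>, for instance the product of
  \<open>n + 1\<close> copies of the real line with density \<open>f(x\<^sub>0) \<dots> f(x\<^sub>n)\<close>.
\<close>

definition iid_pseudo_sequence ::
    "(nat \<Rightarrow> 'b measure) \<Rightarrow> (nat \<Rightarrow> 'b \<Rightarrow> real) \<Rightarrow> (nat \<Rightarrow> nat \<Rightarrow> 'b \<Rightarrow> real) \<Rightarrow> (real \<Rightarrow> real) \<Rightarrow> bool"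
  where
  "iid_pseudo_sequence \<nu> w U f \<longleftrightarrow>
     (\<forall>n. pseudo_prob_space (\<nu> n) (w n) \<and>
          (\<forall>j\<le>n. has_signed_density (\<nu> n) (w n) (U n j) f) \<and>
          pseudo_indep (\<nu> n) (w n) (U n) {..n})"

text \<open>
  Fourier transform of the law of \<open>\<Sum>j\<le>K. U\<^sub>j Q\<^sub>j\<close>, where the genuine random variables \<open>K\<close>
  and \<open>Q\<^sub>j\<close> on \<open>P\<close> are independent of the pseudo random variables: the pseudo expectation is taken
  first, for fixed values of \<open>K\<close> and \<open>Q\<^sub>j\<close>.
\<close>

definition random_sum_char ::
    "'a measure \<Rightarrow> (nat \<Rightarrow> 'b measure) \<Rightarrow> (nat \<Rightarrow> 'b \<Rightarrow> real) \<Rightarrow> (nat \<Rightarrow> nat \<Rightarrow> 'b \<Rightarrow> real) \<Rightarrow>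
      ('a \<Rightarrow> nat) \<Rightarrow> (nat \<Rightarrow> 'a \<Rightarrow> real) \<Rightarrow> real \<Rightarrow> complex" where
  "random_sum_char P \<nu> w U K Q \<xi> =
     (LINT \<omega>|P. pseudo_char (\<nu> (K \<omega>)) (w (K \<omega>)) (\<lambda>\<eta>. \<Sum>j\<le>K \<omega>. U (K \<omega>) j \<eta> * Q j \<omega>) \<xi>)"


section \<open>Poisson process and stable subordinator\<close>

text \<open>
  Processes are indexed by \<open>[0, \<infinity>)\<close>; values at negative times are irrelevant.
\<close>

definition increasing_indep_increments ::
    "'a measure \<Rightarrow> 'v measure \<Rightarrow> (real \<Rightarrow> 'a \<Rightarrow> 'v::{linorder_topology, zero, minus}) \<Rightarrow> bool" where
  "increasing_indep_increments P K X \<longleftrightarrow>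
     (\<forall>t\<ge>0. X t \<in> measurable P K) \<and>
     (AE \<omega> in P. X 0 \<omega> = 0) \<and>
     (AE \<omega> in P. \<forall>s\<ge>0. (\<forall>t\<ge>s. X s \<omega> \<le> X t \<omega>) \<and> continuous (at_right s) (\<lambda>t. X t \<omega>)) \<and>
     (\<forall>n (\<tau>::nat \<Rightarrow> real). 0 \<le> \<tau> 0 \<and> mono \<tau> \<longrightarrow>
        prob_space.indep_vars P (\<lambda>_. K) (\<lambda>i \<omega>. X (\<tau> (Suc i)) \<omega> - X (\<tau> i) \<omega>) {..<n})"

definition poisson_process :: "'a measure \<Rightarrow> real \<Rightarrow> (real \<Rightarrow> 'a \<Rightarrow> nat) \<Rightarrow> bool" where
  "poisson_process P r N \<longleftrightarrow>
     increasing_indep_increments P (count_space UNIV) N \<and>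
     (\<forall>s t. 0 \<le> s \<and> s < t \<longrightarrow>
        distr P (count_space UNIV) (\<lambda>\<omega>. N t \<omega> - N s \<omega>) = measure_pmf (poisson_pmf (r * (t - s))))"

text \<open>\<open>h s t\<close> is the density at \<open>s\<close> of the variable \<open>H t\<close>.\<close>

definition stable_subordinator ::
    "'a measure \<Rightarrow> real \<Rightarrow> (real \<Rightarrow> 'a \<Rightarrow> real) \<Rightarrow> (real \<Rightarrow> real \<Rightarrow> real) \<Rightarrow> bool" where
  "stable_subordinator P \<beta> H h \<longleftrightarrow>
     increasing_indep_increments P borel H \<and>
     (\<forall>s t. 0 \<le> s \<and> s < t \<longrightarrow>
        distr P borel (\<lambda>\<omega>. H t \<omega> - H s \<omega>) = distr P borel (H (t - s))) \<and>
     (\<forall>t>0. (\<forall>s. 0 \<le> h s t) \<and> (\<forall>s<0. h s t = 0) \<and>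
        distributed P lborel (H t) (\<lambda>s. ennreal (h s t)) \<and>
        (\<forall>\<mu>\<ge>0. set_integrable lborel {0..} (\<lambda>s. exp (- \<mu> * s) * h s t) \<and>
           (LINT s:{0..}|lborel. exp (- \<mu> * s) * h s t) = exp (- t * \<mu> powr \<beta>)))"

text \<open>The signed density of \<open>U(H(t))\<close> for independent \<open>U\<close> and \<open>H\<close>.\<close>

definition subordinated_density ::
    "(real \<Rightarrow> real \<Rightarrow> real) \<Rightarrow> (real \<Rightarrow> real \<Rightarrow> real) \<Rightarrow> real \<Rightarrow> real \<Rightarrow> real" where
  "subordinated_density u h t x = (LINT s:{0..}|lborel. u x s * h s t)"


section \<open>Jump sizes\<close>

definition iid_pareto :: "'a measure \<Rightarrow> real \<Rightarrow> real \<Rightarrow> (nat \<Rightarrow> 'a \<Rightarrow> real) \<Rightarrow> bool" where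
  "iid_pareto P \<gamma> \<alpha> Q \<longleftrightarrow>
     prob_space.indep_vars P (\<lambda>_. borel) Q UNIV \<and>
     (\<forall>j. (\<forall>y<\<gamma>. measure P {\<omega> \<in> space P. Q j \<omega> > y} = 1) \<and>
          (\<forall>y>\<gamma>. measure P {\<omega> \<in> space P. Q j \<omega> > y} = (\<gamma> / y) powr \<alpha>))"

text \<open>
  Independence of the whole process \<open>N\<close> and the whole sequence \<open>Q\<close>, stated through the generated
  \<open>\<sigma>\<close>-algebras.
\<close>

definition process_indep_sequence ::
    "'a measure \<Rightarrow> (real \<Rightarrow> 'a \<Rightarrow> nat) \<Rightarrow> (nat \<Rightarrow> 'a \<Rightarrow> real) \<Rightarrow> bool" where
  "process_indep_sequence P N Q \<longleftrightarrow>
     prob_space.indep_set P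
       (sets (vimage_algebra (space P) (\<lambda>\<omega>. \<lambda>t\<in>{0..}. N t \<omega>) (\<Pi>\<^sub>M t\<in>{0..}. count_space UNIV)))
       (sets (vimage_algebra (space P) (\<lambda>\<omega> j. Q j \<omega>) (\<Pi>\<^sub>M j\<in>UNIV. borel)))"

end

theory Submission
  imports Defs
begin

text \<open>
  Put \<open>b = \<bar>\<xi>\<bar> ^ (2 k)\<close>.  Conditioning on the genuine variables turns the Fourier transform of the
  random sum into \<open>\<phi> exp (- r (1 - \<phi>))\<close> with \<open>\<phi> = E exp (- b Q ^ (2 k))\<close> and
  \<open>r = \<lambda> t \<gamma> powr (- 2 k \<beta>)\<close>.  Integrating the tail of \<open>b Q ^ (2 k)\<close> against \<open>exp (- z)\<close> and dominated
  convergence give \<open>\<gamma> powr (- 2 k \<beta>) (1 - \<phi>) \<longlongrightarrow> \<Gamma>(1 - \<beta>) b powr \<beta>\<close>, so the limit is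
  \<open>exp (- t b powr \<beta>)\<close>.  That this is the transform of the subordinated density is Fubini's theorem;
  its integrability hypothesis follows from the scaling
  \<open>u x s = c u (c x) 1\<close>, \<open>c = s powr (- 1 / (2 k))\<close>, which makes the \<open>L\<^sup>1\<close> norm of \<open>u\<close> constant in time
  and \<open>u\<close> jointly measurable.  The scaling follows from injectivity of the Fourier transform.
\<close>

section \<open>Signed laws and the Fourier transform\<close>

text \<open>A simple function is a finite combination of indicators of its level sets, so the
  defining identity of \<open>has_signed_density\<close> extends to it by linearity.\<close>

lemma has_signed_density_integral_simple:
  fixes s :: "real \<Rightarrow> complex"
  assumes d: "has_signed_density M w X f" and w: "integrable M w" and s: "simple_function borel s"
  shows "(LINT \<eta>|M. of_real (w \<eta>) * s (X \<eta>)) = (LINT x|lborel. of_real (f x) * s x)"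
proof -
  have X[measurable]: "X \<in> borel_measurable M" and f: "integrable lborel f"
    and eq: "\<And>A. A \<in> sets borel \<Longrightarrow> (LINT \<eta>|M. w \<eta> * indicator A (X \<eta>)) = (LINT x:A|lborel. f x)"
    using d by (auto simp: has_signed_density_def)
  note [measurable] = borel_measurable_integrable[OF w] borel_measurable_integrable[OF f]
  have fin: "finite (range s)" using s by (auto simp: simple_function_def)
  have [measurable]: "s -` {y} \<in> sets borel" for y
    using measurable_sets[OF borel_measurable_simple_function[OF s], of "{y}"] by simp
  have rep: "s x = (\<Sum>y\<in>range s. y * of_real (indicator (s -` {y}) x))" for x
  proof -
    have "(\<Sum>y\<in>range s. y * of_real (indicator (s -` {y}) x)) = (\<Sum>y\<in>range s. if s x = y then y else 0)"
      by (rule sum.cong) auto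
    then show ?thesis using fin by simp
  qed
  have i1: "integrable M (\<lambda>\<eta>. w \<eta> * indicator (s -` {y}) (X \<eta>))" for y
    by (rule Bochner_Integration.integrable_bound[OF w], measurable) (auto simp: indicator_def)
  have i2: "integrable lborel (\<lambda>x. f x * indicator (s -` {y}) x)" for y
    by (rule Bochner_Integration.integrable_bound[OF f], measurable) (auto simp: indicator_def)
  have "(LINT \<eta>|M. of_real (w \<eta>) * s (X \<eta>))
      = (LINT \<eta>|M. (\<Sum>y\<in>range s. y * of_real (w \<eta> * indicator (s -` {y}) (X \<eta>))))"
    by (subst rep) (simp add: sum_distrib_left mult_ac)
  also have "\<dots> = (\<Sum>y\<in>range s. y * of_real (LINT \<eta>|M. w \<eta> * indicator (s -` {y}) (X \<eta>)))"
    by (subst Bochner_Integration.integral_sum)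
       (auto intro!: integrable_mult_right integrable_of_real i1
             simp del: of_real_mult simp: integral_complex_of_real)
  also have "\<dots> = (\<Sum>y\<in>range s. y * of_real (LINT x|lborel. f x * indicator (s -` {y}) x))"
    by (simp add: eq set_lebesgue_integral_def mult.commute)
  also have "\<dots> = (LINT x|lborel. (\<Sum>y\<in>range s. y * of_real (f x * indicator (s -` {y}) x)))"
    by (subst Bochner_Integration.integral_sum)
       (auto intro!: integrable_mult_right integrable_of_real i2
             simp del: of_real_mult simp: integral_complex_of_real)
  also have "\<dots> = (LINT x|lborel. of_real (f x) * s x)"
    by (subst rep) (simp add: sum_distrib_left mult_ac)
  finally show ?thesis .
qed

text \<open>Approximate \<open>g\<close> pointwise by simple functions of norm at most
  \<open>2 * norm (g x)\<close>. The uniform bound \<open>2 * B\<close>, multiplied by the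
  integrable \<open>\<bar>w\<bar>\<close> or \<open>\<bar>f\<bar>\<close>, dominates on either
  side.\<close>

lemma has_signed_density_integral:
  fixes g :: "real \<Rightarrow> complex"
  assumes d: "has_signed_density M w X f" and w: "integrable M w"
    and g: "g \<in> borel_measurable borel" and B: "\<And>x. norm (g x) \<le> B"
  shows "(LINT \<eta>|M. of_real (w \<eta>) * g (X \<eta>)) = (LINT x|lborel. of_real (f x) * g x)"
proof -
  have X[measurable]: "X \<in> borel_measurable M" and f: "integrable lborel f"
    using d by (auto simp: has_signed_density_def)
  note [measurable] = g borel_measurable_integrable[OF w] borel_measurable_integrable[OF f]
  obtain s where s: "\<And>i. simple_function borel (s i)" and lim: "\<And>x. (\<lambda>i. s i x) \<longlonglongrightarrow> g x"
    and bd: "\<And>i x. norm (s i x) \<le> 2 * norm (g x)"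
    using borel_measurable_implies_sequence_metric[OF g, of 0] by (auto simp: dist_norm)
  have [measurable]: "s i \<in> borel_measurable borel" for i
    by (rule borel_measurable_simple_function[OF s])
  have bd': "norm (s i x) \<le> 2 * B" for i x using bd[of i x] B[of x] by linarith
  have "(\<lambda>i. LINT \<eta>|M. of_real (w \<eta>) * s i (X \<eta>)) \<longlonglongrightarrow> (LINT \<eta>|M. of_real (w \<eta>) * g (X \<eta>))"
    by (rule integral_dominated_convergence[where w="\<lambda>\<eta>. norm (w \<eta>) * (2 * B)"])
       (auto intro!: integrable_mult_left integrable_norm w tendsto_mult lim AE_I2
          mult_left_mono bd' simp: norm_mult)
  moreover have "(\<lambda>i. LINT x|lborel. of_real (f x) * s i x) \<longlonglongrightarrow> (LINT x|lborel. of_real (f x) * g x)"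
    by (rule integral_dominated_convergence[where w="\<lambda>x. norm (f x) * (2 * B)"])
       (auto intro!: integrable_mult_left integrable_norm f tendsto_mult lim AE_I2
          mult_left_mono bd' simp: norm_mult)
  ultimately show ?thesis
    using has_signed_density_integral_simple[OF d w s] LIMSEQ_unique by auto
qed

text \<open>The exponential of norm 1 is a bounded test function, and the factor \<open>c\<close> is
  absorbed into its frequency.\<close>

lemma pseudo_char_scale:
  assumes "has_signed_density M w X f" and "integrable M w"
  shows "pseudo_char M w (\<lambda>\<eta>. c * X \<eta>) \<xi> = fourier f (c * \<xi>)"
  unfolding pseudo_char_def fourier_def
  using has_signed_density_integral[OF assms, of "\<lambda>x. iexp (\<xi> * (c * x))" 1]
  by (simp add: mult_ac)

section \<open>Injectivity of the Fourier transform\<close>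

text \<open>Levy's uniqueness theorem concerns probability laws; dividing a nonnegative density by
  its mass makes it applicable.\<close>

lemma density_normalized_char:
  assumes p: "integrable lborel p" "\<And>x. 0 \<le> p x" and m: "(LINT x|lborel. p x) = m" "m > 0"
  shows "real_distribution (density lborel (\<lambda>x. ennreal (p x / m)))"
    and "char (density lborel (\<lambda>x. ennreal (p x / m))) \<xi> = fourier p \<xi> / of_real m"
proof -
  note [measurable] = borel_measurable_integrable[OF p(1)]
  have "(\<integral>\<^sup>+x. ennreal (p x / m) \<partial>lborel) = ennreal (LINT x|lborel. p x / m)"
    using p m by (intro nn_integral_eq_integral) auto
  also have "\<dots> = 1" using m by simp
  finally show "real_distribution (density lborel (\<lambda>x. ennreal (p x / m)))"
    by (auto intro!: real_distribution.intro prob_spaceI simp: real_distribution_axioms_def emeasure_density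
        cong: nn_integral_cong)
  have "char (density lborel (\<lambda>x. ennreal (p x / m))) \<xi> = (LINT x|lborel. (p x / m) *\<^sub>R iexp (\<xi> * x))"
    unfolding char_def using p m by (subst integral_density) (auto)
  also have "\<dots> = (LINT x|lborel. of_real (p x) * iexp (\<xi> * x) / of_real m)"
    by (simp add: scaleR_conv_of_real)
  also have "\<dots> = fourier p \<xi> / of_real m"
    unfolding fourier_def by (rule integral_divide_zero)
  finally show "char (density lborel (\<lambda>x. ennreal (p x / m))) \<xi> = fourier p \<xi> / of_real m" .
qed

lemma fourier_diff:
  assumes f: "integrable lborel f" and g: "integrable lborel g"
  shows "fourier (\<lambda>x. f x - g x) \<xi> = fourier f \<xi> - fourier g \<xi>"
proof -
  note [measurable] = borel_measurable_integrable[OF f] borel_measurable_integrable[OF g]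
  have "integrable lborel (\<lambda>x. of_real (f x) * iexp (\<xi> * x))"
    by (rule Bochner_Integration.integrable_bound[OF f]) (auto simp: norm_mult)
  moreover have "integrable lborel (\<lambda>x. of_real (g x) * iexp (\<xi> * x))"
    by (rule Bochner_Integration.integrable_bound[OF g]) (auto simp: norm_mult)
  ultimately show ?thesis
    unfolding fourier_def by (simp add: algebra_simps)
qed

lemma fourier_zero: "fourier f 0 = of_real (LINT x|lborel. f x)"
  by (simp add: fourier_def integral_complex_of_real)

text \<open>The positive and negative parts of \<open>f\<close> have equal transforms, hence equal
  masses (frequency 0). Normalised, they are densities of one and the same probability law, so they
  agree almost everywhere.\<close>

lemma fourier_eq_zero_imp_AE_zero:
  assumes f: "integrable lborel f" and zero: "\<And>\<xi>. fourier f \<xi> = 0"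
  shows "AE x in lborel. f x = 0"
proof -
  define p n where "p x = max 0 (f x)" and "n x = max 0 (- f x)" for x
  have fpn: "f = (\<lambda>x. p x - n x)" by (auto simp: p_def n_def)
  have int: "integrable lborel p" "integrable lborel n"
    using f unfolding p_def n_def by (auto intro!: integrable_max)
  have nn: "0 \<le> p x" "0 \<le> n x" for x by (auto simp: p_def n_def)
  note [measurable] = borel_measurable_integrable[OF int(1)] borel_measurable_integrable[OF int(2)]
  have eq: "fourier p \<xi> = fourier n \<xi>" for \<xi>
    using zero[of \<xi>] fourier_diff[OF int, of \<xi>] unfolding fpn by simp
  define m where "m = (LINT x|lborel. p x)"
  have m: "(LINT x|lborel. p x) = m" "(LINT x|lborel. n x) = m"
    using eq[of 0] by (auto simp: m_def fourier_zero)
  show ?thesis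
  \<comment> \<open>Mass zero cannot be normalised, but then both parts, being nonnegative, vanish
    almost everywhere.\<close>
  proof (cases "m = 0")
    case True
    have "AE x in lborel. p x = 0" "AE x in lborel. n x = 0"
      using integral_nonneg_eq_0_iff_AE[OF int(1)] integral_nonneg_eq_0_iff_AE[OF int(2)]
      by (simp_all only: m True nn AE_I2 simp_thms)
    then show ?thesis unfolding fpn by eventually_elim simp
  next
    case False
    then have m0: "m > 0" using m nn Bochner_Integration.integral_nonneg[of lborel p] by simp
    have "char (density lborel (\<lambda>x. ennreal (p x / m))) = char (density lborel (\<lambda>x. ennreal (n x / m)))"
      using density_normalized_char(2)[OF int(1) nn(1) m(1) m0]
        density_normalized_char(2)[OF int(2) nn(2) m(2) m0] eq by (auto simp: fun_eq_iff)
    then have "density lborel (\<lambda>x. ennreal (p x / m)) = density lborel (\<lambda>x. ennreal (n x / m))"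
      by (intro Levy_uniqueness density_normalized_char(1) int nn m m0)
    then have "AE x in lborel. ennreal (p x / m) = ennreal (n x / m)"
      by (intro sigma_finite_measure.density_unique[OF sigma_finite_lborel]) auto
    then show ?thesis unfolding fpn
      by eventually_elim (use m0 nn in \<open>simp add: divide_nonneg_pos\<close>)
  qed
qed

text \<open>The set where \<open>f\<close> does not vanish is open, and a nonempty open set is not
  negligible.\<close>

lemma continuous_AE_zero_imp_zero:
  fixes f :: "'a::euclidean_space \<Rightarrow> real"
  assumes c: "continuous_on UNIV f" and ae: "AE x in lborel. f x = 0"
  shows "f x = 0"
proof (rule ccontr)
  assume "f x \<noteq> 0"
  have op: "open {x. f x \<noteq> 0}"
    by (rule open_Collect_neq) (use c in auto)
  have "{x. f x \<noteq> 0} \<in> null_sets lebesgue"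
    using AE_iff_null_sets[of "{x. f x \<noteq> 0}" lborel] op ae by (intro null_sets_completionI) auto
  then show False
    using open_not_negligible[OF op] \<open>f x \<noteq> 0\<close> by (auto simp: negligible_iff_null_sets)
qed

text \<open>Continuity upgrades the almost everywhere equality to the pointwise one that the scaling
  identity asks for.\<close>

lemma fourier_unique:
  assumes f: "integrable lborel f" "continuous_on UNIV f"
    and g: "integrable lborel g" "continuous_on UNIV g"
    and eq: "\<And>\<xi>. fourier f \<xi> = fourier g \<xi>"
  shows "f = g"
proof
  fix x
  have "AE x in lborel. f x - g x = 0"
    by (rule fourier_eq_zero_imp_AE_zero) (use f g eq in \<open>auto simp: fourier_diff\<close>)
  then have "f x - g x = 0"
    by (rule continuous_AE_zero_imp_zero[rotated]) (intro continuous_intros f g)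
  then show "f x = g x" by simp
qed


section \<open>Scaling and subordination\<close>

lemma fourier_scale:
  assumes "c > 0"
  shows "fourier (\<lambda>x. c * f (c * x)) \<xi> = fourier f (\<xi> / c)"
  unfolding fourier_def
  using lborel_integral_real_affine[of c "\<lambda>x. of_real (f x) * iexp (\<xi> / c * x)" 0] assms
  by (simp add: scaleR_conv_of_real mult.assoc flip: integral_mult_right_zero)

lemma fundamental_solution_integrable:
  "fundamental_solution k u \<Longrightarrow> s > 0 \<Longrightarrow> integrable lborel (\<lambda>x. u x s)"
  by (simp add: fundamental_solution_def)

lemma fundamental_solution_fourier:
  "fundamental_solution k u \<Longrightarrow> s > 0 \<Longrightarrow>
    fourier (\<lambda>x. u x s) \<xi> = of_real (exp (- s * \<bar>\<xi>\<bar> ^ (2 * k)))"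
  by (simp add: fundamental_solution_def)

text \<open>This is read off the differentiability clause at order 0, which is below
  \<open>2 * k\<close> since \<open>k \<ge> 1\<close>.\<close>

lemma fundamental_solution_continuous:
  assumes "fundamental_solution k u" "k \<ge> 1" "s > 0"
  shows "continuous_on UNIV (\<lambda>x. u x s)"
proof (rule continuous_at_imp_continuous_on, rule ballI)
  fix x
  have "0 < 2 * k" using assms(2) by simp
  then have "(deriv ^^ 0) (\<lambda>y. u y s) differentiable (at x)"
    using assms unfolding fundamental_solution_def by blast
  then show "isCont (\<lambda>x. u x s) x" by (simp add: differentiable_imp_continuous_within)
qed

text \<open>Both sides are continuous and integrable with the same transform: rescaling replaces
  \<open>\<xi>\<close> by \<open>\<xi> / c\<close>, and \<open>c ^ (2 * k) = 1 / s\<close> turns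
  time 1 into time \<open>s\<close>. The right-hand side is visibly measurable in \<open>x\<close>
  and \<open>s\<close> jointly.\<close>

lemma fundamental_solution_scaling:
  assumes u: "fundamental_solution k u" and k: "k \<ge> 1" and s: "s > 0"
  defines "c \<equiv> s powr (- 1 / (2 * real k))"
  shows "u x s = c * u (c * x) 1"
proof -
  have c: "c > 0" using s by (simp add: c_def)
  have "c ^ (2 * k) = s powr (- 1 / (2 * real k) * real (2 * k))"
    using c unfolding c_def by (subst powr_realpow[symmetric]) (simp_all add: powr_powr)
  also have "\<dots> = 1 / s" using s k by (simp add: powr_minus_divide)
  finally have ck: "c ^ (2 * k) = 1 / s" .
  have int: "integrable lborel (\<lambda>x. c * u (c * x) 1)"
    using lborel_integrable_real_affine[OF fundamental_solution_integrable[OF u, of 1], of c 0] c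
    by simp
  have "(\<lambda>x. u x s) = (\<lambda>x. c * u (c * x) 1)"
  proof (rule fourier_unique)
    show "continuous_on UNIV (\<lambda>x. c * u (c * x) 1)"
      using continuous_on_compose2[OF fundamental_solution_continuous[OF u k, of 1], of UNIV "\<lambda>x. c * x"]
      by (intro continuous_intros) auto
    have "\<bar>\<xi> / c\<bar> ^ (2 * k) = s * \<bar>\<xi>\<bar> ^ (2 * k)" for \<xi>
      using c by (simp add: power_divide ck)
    then show "fourier (\<lambda>x. u x s) \<xi> = fourier (\<lambda>x. c * u (c * x) 1) \<xi>" for \<xi>
      using fourier_scale[OF c, of "\<lambda>x. u x 1" \<xi>] c s
      by (simp add: fundamental_solution_fourier[OF u] del: abs_divide)
  qed (use s int in \<open>auto intro: fundamental_solution_integrable[OF u]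
         fundamental_solution_continuous[OF u k] simp del: integrable_mult_right_iff\<close>)
  then show ?thesis by (rule fun_cong)
qed

section \<open>Fourier transform of a subordinated density\<close>

text \<open>Interchange the integrals over \<open>x\<close> and \<open>s\<close>. By scaling, the
  \<open>L1\<close> norm of \<open>u\<close> in \<open>x\<close> equals the same constant
  \<open>A\<close> at every positive time, so the double integral converges absolutely.\<close>

lemma fourier_subordination:
  assumes u: "fundamental_solution k u" and k: "k \<ge> 1"
    and \<eta>: "set_integrable lborel {0..} \<eta>"
  shows "fourier (\<lambda>x. LINT s:{0..}|lborel. u x s * \<eta> s) \<xi>
    = of_real (LINT s:{0..}|lborel. exp (- (\<bar>\<xi>\<bar> ^ (2 * k)) * s) * \<eta> s)"
proof -
  \<comment> \<open>Nothing is known of \<open>u x s\<close> for \<open>s \<le> 0\<close>, so the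
    weight is cut off to \<open>s > 0\<close>; the lost point 0 is a null set. The second indicator
    stays because \<open>\<eta>\<close> is assumed integrable only on \<open>{0..}\<close>.\<close>
  define e where "e s = indicator {0<..} s * (indicator {0..} s * \<eta> s)" for s :: real
  have e_int: "integrable lborel e"
    using integrable_mult_indicator[of "{0<..}" lborel "\<lambda>s. indicator {0..} s * \<eta> s"] \<eta>
    by (simp add: e_def[abs_def] set_integrable_def)
  define c where "c s = s powr (- 1 / (2 * real k))" for s :: real
  define A where "A = (LINT x|lborel. \<bar>u x 1\<bar>)"
  have u1: "integrable lborel (\<lambda>x. u x 1)" by (rule fundamental_solution_integrable[OF u]) simp
  have [measurable]: "(\<lambda>x. u x 1) \<in> borel_measurable borel" "e \<in> borel_measurable borel"
    using borel_measurable_integrable[OF u1] borel_measurable_integrable[OF e_int] by auto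
  have [measurable]: "c \<in> borel_measurable borel" unfolding c_def[abs_def] by measurable
  have c0: "c s > 0" if "s > 0" for s using that by (simp add: c_def)
  have us: "u x s = c s * u (c s * x) 1" if "s > 0" for x s
    using fundamental_solution_scaling[OF u k that] by (simp add: c_def)
  have u_norm: "(LINT x|lborel. \<bar>u x s\<bar>) = A" if "s > 0" for s
    using lborel_integral_real_affine[of "c s" "\<lambda>x. \<bar>u x 1\<bar>" 0] c0[OF that]
    by (simp add: us[OF that] A_def abs_mult flip: integral_mult_right_zero)
  \<comment> \<open>Expressing \<open>u x s\<close> through the time-one function makes joint
    measurability evident. For \<open>s \<le> 0\<close> the factor \<open>e s\<close> vanishes, so
    the next fact holds for all \<open>s\<close>.\<close>
  define G where "G s x = of_real (e s * (c s * u (c s * x) 1)) * iexp (\<xi> * x)" for s x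
  have G: "G s x = of_real (e s) * (of_real (u x s) * iexp (\<xi> * x))" for s x
    by (cases "s > 0") (auto simp: G_def e_def us[where s=s])
  have G_int: "integrable (lborel \<Otimes>\<^sub>M lborel) (case_prod G)"
  proof (rule lborel_pair.Fubini_integrable)
    show "case_prod G \<in> borel_measurable (lborel \<Otimes>\<^sub>M lborel)"
      unfolding G_def[abs_def] by measurable
    have "(\<lambda>s. LINT x|lborel. norm (case_prod G (s, x))) = (\<lambda>s. \<bar>e s\<bar> * A)"
    proof
      fix s
      show "(LINT x|lborel. norm (case_prod G (s, x))) = \<bar>e s\<bar> * A"
        by (cases "s > 0") (auto simp: G norm_mult u_norm e_def)
    qed
    then show "integrable lborel (\<lambda>s. LINT x|lborel. norm (case_prod G (s, x)))"
      using e_int by simp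
    have "integrable lborel (\<lambda>x. G s x)" for s
    proof (cases "s > 0")
      case True
      have us_int: "integrable lborel (\<lambda>x. u x s)"
        by (rule fundamental_solution_integrable[OF u True])
      have "integrable lborel (\<lambda>x. of_real (u x s) * iexp (\<xi> * x))"
        by (rule Bochner_Integration.integrable_bound[OF us_int])
           (use borel_measurable_integrable[OF us_int] in \<open>auto simp: norm_mult\<close>)
      then show ?thesis unfolding G by (intro integrable_mult_right)
    qed (simp add: G e_def)
    then show "AE s in lborel. integrable lborel (\<lambda>x. case_prod G (s, x))" by simp
  qed
  have eu: "e s * (c s * u (c s * x) 1) = e s * u x s" for s x
    by (cases "s > 0") (auto simp: e_def us[where s=s])
  have inner: "of_real (LINT s:{0..}|lborel. u x s * \<eta> s) * iexp (\<xi> * x) = (LINT s|lborel. G s x)" for x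
  proof -
    have "(LINT s:{0..}|lborel. u x s * \<eta> s) = (LINT s|lborel. e s * (c s * u (c s * x) 1))"
      unfolding set_lebesgue_integral_def eu
      by (rule integral_discrete_difference[where X="{0}"]) (auto simp: e_def indicator_def)
    then show ?thesis
      unfolding G_def by (simp add: integral_complex_of_real del: of_real_mult)
  qed
  have outer: "(LINT x|lborel. G s x) = of_real (e s * exp (- s * \<bar>\<xi>\<bar> ^ (2 * k)))" for s
  proof (cases "s > 0")
    case True
    then show ?thesis
      using fundamental_solution_fourier[OF u True, of \<xi>] by (simp add: G fourier_def)
  qed (simp add: G e_def)
  have "fourier (\<lambda>x. LINT s:{0..}|lborel. u x s * \<eta> s) \<xi> = (LINT x|lborel. LINT s|lborel. G s x)"
    unfolding fourier_def inner ..
  also have "\<dots> = (LINT s|lborel. LINT x|lborel. G s x)"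
    by (rule lborel_pair.Fubini_integral[OF G_int])
  also have "\<dots> = of_real (LINT s|lborel. e s * exp (- s * \<bar>\<xi>\<bar> ^ (2 * k)))"
    unfolding outer by (rule integral_complex_of_real)
  also have "(LINT s|lborel. e s * exp (- s * \<bar>\<xi>\<bar> ^ (2 * k)))
      = (LINT s:{0..}|lborel. exp (- (\<bar>\<xi>\<bar> ^ (2 * k)) * s) * \<eta> s)"
    unfolding set_lebesgue_integral_def
    by (rule integral_discrete_difference[where X="{0}"]) (auto simp: e_def indicator_def mult_ac)
  finally show ?thesis .
qed

text \<open>Use the Laplace transform of \<open>h\<close> at
  \<open>\<mu> = \<bar>\<xi>\<bar> ^ (2 * k)\<close>; its instance \<open>\<mu> = 0\<close> supplies
  integrability of the density.\<close>

lemma fourier_subordinated_density: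
  assumes u: "fundamental_solution k u" and k: "k \<ge> 1"
    and H: "stable_subordinator P' \<beta> H h" and t: "t > 0"
  shows "fourier (subordinated_density u h t) \<xi> = of_real (exp (- t * (\<bar>\<xi>\<bar> ^ (2 * k)) powr \<beta>))"
proof -
  have L: "set_integrable lborel {0..} (\<lambda>s. exp (- \<mu> * s) * h s t) \<and>
      (LINT s:{0..}|lborel. exp (- \<mu> * s) * h s t) = exp (- t * \<mu> powr \<beta>)" if "\<mu> \<ge> 0" for \<mu>
    using H t that unfolding stable_subordinator_def by blast
  have "set_integrable lborel {0..} (\<lambda>s. h s t)"
    using L[of 0] by simp
  from fourier_subordination[OF u k this, of \<xi>] L[of "\<bar>\<xi>\<bar> ^ (2 * k)"]
  show ?thesis by (simp add: subordinated_density_def[abs_def])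
qed


section \<open>Pareto jumps\<close>

text \<open>Up to the null set of end points this is the integral of \<open>exp (- z)\<close> over
  \<open>{0..a}\<close>.\<close>

lemma exp_minus_layer_integral:
  fixes a :: real
  assumes "a \<ge> 0"
  shows "has_bochner_integral lborel
    (\<lambda>z. indicator {0<..} z * exp (- z) * indicator {z. z < a} z) (1 - exp (- a))"
proof -
  have D: "has_bochner_integral lborel (\<lambda>z. exp (- z) * indicator {0..a} z) (- exp (- a) - - exp (- 0))"
    by (rule has_bochner_integral_FTC_Icc_nonneg) (use assms in \<open>auto intro!: derivative_eq_intros continuous_intros\<close>)
  have "integrable lborel (\<lambda>z. indicator {0<..} z * exp (- z) * indicator {z. z < a} z)
      = integrable lborel (\<lambda>z. exp (- z) * indicator {0..a} z)"
    by (rule integrable_discrete_difference[where X="{0, a}"]) (auto simp: indicator_def)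
  moreover have "(LINT z|lborel. indicator {0<..} z * exp (- z) * indicator {z. z < a} z)
      = (LINT z|lborel. exp (- z) * indicator {0..a} z)"
    by (rule integral_discrete_difference[where X="{0, a}"]) (auto simp: indicator_def)
  ultimately show ?thesis using D by (simp add: has_bochner_integral_iff)
qed

text \<open>Write \<open>1 - exp (- Z)\<close> as the integral of \<open>exp (- z)\<close> over
  \<open>0 < z < Z\<close> and interchange with the expectation: the inner integral becomes the tail
  of \<open>Z\<close>, the form in which the Pareto law is given.\<close>

lemma (in prob_space) expectation_exp_minus_layer:
  assumes Z[measurable]: "random_variable borel Z" and nn: "\<And>\<omega>. \<omega> \<in> space M \<Longrightarrow> 0 \<le> Z \<omega>"
  shows "1 - expectation (\<lambda>\<omega>. exp (- Z \<omega>))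
    = (LINT z|lborel. indicator {0<..} z * exp (- z) * prob {\<omega> \<in> space M. z < Z \<omega>})"
proof -
  interpret pair_sigma_finite M "lborel :: real measure" ..
  define F where "F \<omega> z = indicator {0<..} z * exp (- z) * indicator {z. z < Z \<omega>} z" for \<omega> and z :: real
  have F_meas[measurable]: "case_prod F \<in> borel_measurable (M \<Otimes>\<^sub>M lborel)"
    unfolding F_def[abs_def] indicator_def by measurable
  have F_int: "has_bochner_integral lborel (F \<omega>) (1 - exp (- Z \<omega>))" if "\<omega> \<in> space M" for \<omega>
    using exp_minus_layer_integral[OF nn[OF that]] unfolding F_def .
  have exp_int: "integrable M (\<lambda>\<omega>. exp (- Z \<omega>))"
    by (rule integrable_const_bound[where B=1]) (auto simp: nn)
  have FF: "integrable (M \<Otimes>\<^sub>M lborel) (case_prod F)"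
  proof (rule Fubini_integrable)
    have "(LINT z|lborel. norm (case_prod F (\<omega>, z))) = 1 - exp (- Z \<omega>)" if "\<omega> \<in> space M" for \<omega>
    proof -
      have "norm (case_prod F (\<omega>, z)) = F \<omega> z" for z by (simp add: F_def)
      then show ?thesis using F_int[OF that] by (simp add: has_bochner_integral_iff)
    qed
    then show "integrable M (\<lambda>\<omega>. LINT z|lborel. norm (case_prod F (\<omega>, z)))"
      using exp_int by (simp cong: Bochner_Integration.integrable_cong)
    show "AE \<omega> in M. integrable lborel (\<lambda>z. case_prod F (\<omega>, z))"
      using F_int by (auto simp: has_bochner_integral_iff)
  qed measurable
  have "1 - expectation (\<lambda>\<omega>. exp (- Z \<omega>)) = (LINT \<omega>|M. 1 - exp (- Z \<omega>))"
    using exp_int by (simp add: prob_space)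
  also have "\<dots> = (LINT \<omega>|M. LINT z|lborel. F \<omega> z)"
    by (rule Bochner_Integration.integral_cong) (use F_int in \<open>auto simp: has_bochner_integral_iff\<close>)
  also have "\<dots> = (LINT z|lborel. LINT \<omega>|M. F \<omega> z)"
    by (rule Fubini_integral[OF FF, symmetric])
  also have "(\<lambda>z. LINT \<omega>|M. F \<omega> z) = (\<lambda>z. indicator {0<..} z * exp (- z) * prob {\<omega> \<in> space M. z < Z \<omega>})"
  proof
    fix z
    have "(LINT \<omega>|M. F \<omega> z) = (LINT \<omega>|M. indicator {0<..} z * exp (- z) * indicator {\<omega> \<in> space M. z < Z \<omega>} \<omega>)"
      by (rule Bochner_Integration.integral_cong) (auto simp: F_def indicator_def)
    then show "(LINT \<omega>|M. F \<omega> z) = indicator {0<..} z * exp (- z) * prob {\<omega> \<in> space M. z < Z \<omega>}"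
      by (simp add: Int_def conj_ac cong: conj_cong)
  qed
  finally show ?thesis .
qed

text \<open>The variable \<open>b * \<bar>Q\<bar> ^ (2 * k)\<close> is again Pareto, with scale
  \<open>b * \<gamma> ^ (2 * k)\<close> and exponent \<open>\<beta>\<close>. The level equal to the
  scale corresponds to \<open>y = \<gamma>\<close>, where \<open>iid_pareto\<close> prescribes no
  value.\<close>

lemma pareto_power_tail:
  assumes P: "prob_space P" and Q: "iid_pareto P \<gamma> (2 * real k * \<beta>) Q"
    and "\<gamma> > 0" "k \<ge> 1" "\<beta> > 0" "b > 0" "z > 0" "z \<noteq> b * \<gamma> ^ (2 * k)"
  shows "measure P {\<omega> \<in> space P. z < b * \<bar>Q j \<omega>\<bar> ^ (2 * k)} = min 1 ((b * \<gamma> ^ (2 * k) / z) powr \<beta>)"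
proof -
  interpret prob_space P by fact
  have [measurable]: "Q j \<in> borel_measurable P"
    using Q unfolding iid_pareto_def indep_vars_def by auto
  have lo: "prob {\<omega> \<in> space P. Q j \<omega> > y} = 1" if "y < \<gamma>" for y
    using Q that by (auto simp: iid_pareto_def)
  have hi: "prob {\<omega> \<in> space P. Q j \<omega> > y} = (\<gamma> / y) powr (2 * real k * \<beta>)" if "y > \<gamma>" for y
    using Q that by (auto simp: iid_pareto_def)
  \<comment> \<open>Any level in \<open>[0, \<gamma>)\<close> would do: almost sure positivity
    removes the absolute value and makes the power monotone.\<close>
  have "AE \<omega> in P. Q j \<omega> > \<gamma> / 2"
    using lo[of "\<gamma> / 2"] \<open>\<gamma> > 0\<close> by (subst prob_Collect_eq_1[symmetric]) auto
  then have pos: "AE \<omega> in P. Q j \<omega> > 0" by eventually_elim (use \<open>\<gamma> > 0\<close> in simp)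
  define y where "y = (z / b) powr (1 / (2 * real k))"
  have y0: "y > 0" using assms by (simp add: y_def)
  have yk: "y ^ (2 * k) = z / b"
    using y0 assms unfolding y_def by (subst powr_realpow[symmetric]) (simp_all add: powr_powr)
  have less_iff: "x ^ (2 * k) < x' ^ (2 * k) \<longleftrightarrow> x < x'" if "x \<ge> 0" "x' \<ge> 0" for x x' :: real
    using power_mono_iff[OF that(2,1), of "2 * k"] \<open>k \<ge> 1\<close> by (simp flip: not_le)
  have "prob {\<omega> \<in> space P. z < b * \<bar>Q j \<omega>\<bar> ^ (2 * k)} = prob {\<omega> \<in> space P. Q j \<omega> > y}"
  proof (rule measure_eq_AE)
    show "AE \<omega> in P. (\<omega> \<in> {\<omega> \<in> space P. z < b * \<bar>Q j \<omega>\<bar> ^ (2 * k)}) = (\<omega> \<in> {\<omega> \<in> space P. Q j \<omega> > y})"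
      using pos
    proof eventually_elim
      case (elim \<omega>)
      have "z < b * \<bar>Q j \<omega>\<bar> ^ (2 * k) \<longleftrightarrow> y ^ (2 * k) < Q j \<omega> ^ (2 * k)"
        unfolding yk using elim \<open>b > 0\<close> by (simp add: pos_divide_less_eq mult.commute)
      then show ?case using less_iff[of y "Q j \<omega>"] y0 elim by auto
    qed
  qed measurable
  also have "\<dots> = min 1 ((b * \<gamma> ^ (2 * k) / z) powr \<beta>)"
  proof -
    have e: "b * \<gamma> ^ (2 * k) / z = (\<gamma> / y) ^ (2 * k)"
      using assms by (simp add: power_divide yk)
    have "y \<noteq> \<gamma>" using yk assms by auto
    then consider "y < \<gamma>" | "y > \<gamma>" by linarith
    then show ?thesis
    proof cases
      case 1
      then have "(\<gamma> / y) ^ (2 * k) \<ge> 1" using y0 by (intro one_le_power) simp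
      then show ?thesis using lo[OF 1] \<open>\<beta> > 0\<close> unfolding e by (simp add: ge_one_powr_ge_zero)
    next
      case 2
      have "(\<gamma> / y) ^ (2 * k) \<le> 1" using 2 y0 \<open>\<gamma> > 0\<close> by (intro power_le_one) auto
      then have "((\<gamma> / y) ^ (2 * k)) powr \<beta> \<le> 1"
        using \<open>\<beta> > 0\<close> y0 \<open>\<gamma> > 0\<close> by (intro powr_le1) auto
      moreover have "((\<gamma> / y) ^ (2 * k)) powr \<beta> = (\<gamma> / y) powr (2 * real k * \<beta>)"
        using y0 \<open>\<gamma> > 0\<close> by (subst powr_realpow[symmetric]) (simp_all add: powr_powr)
      ultimately show ?thesis using hi[OF 2] unfolding e by simp
    qed
  qed
  finally show ?thesis .
qed

text \<open>The amount \<open>1 - E exp (- b Q ^ (2 k))\<close> by which the Laplace transform falls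
  short of 1, in its tail form. The variable \<open>\<epsilon>\<close> stands for
  \<open>\<gamma> ^ (2 * k)\<close>, which frees the limit computation from
  \<open>k\<close>.\<close>

definition pareto_deficit :: "real \<Rightarrow> real \<Rightarrow> real \<Rightarrow> real" where
  "pareto_deficit \<beta> b \<epsilon> = (LINT z|lborel. indicator {0<..} z * exp (- z) * min 1 ((b * \<epsilon> / z) powr \<beta>))"

lemma expectation_exp_pareto:
  assumes P: "prob_space P" and Q: "iid_pareto P \<gamma> (2 * real k * \<beta>) Q"
    and "\<gamma> > 0" "k \<ge> 1" "\<beta> > 0" "b \<ge> 0"
  shows "(LINT \<omega>|P. exp (- (b * \<bar>Q j \<omega>\<bar> ^ (2 * k)))) = 1 - pareto_deficit \<beta> b (\<gamma> ^ (2 * k))"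
\<comment> \<open>The tail formula divides by \<open>b\<close>; for \<open>b = 0\<close> both sides
  are 1.\<close>
proof (cases "b = 0")
  case True
  interpret prob_space P by fact
  from True show ?thesis by (simp add: pareto_deficit_def prob_space)
next
  case False
  interpret prob_space P by fact
  have [measurable]: "Q j \<in> borel_measurable P"
    using Q unfolding iid_pareto_def indep_vars_def by auto
  have "1 - expectation (\<lambda>\<omega>. exp (- (b * \<bar>Q j \<omega>\<bar> ^ (2 * k))))
      = (LINT z|lborel. indicator {0<..} z * exp (- z) * prob {\<omega> \<in> space P. z < b * \<bar>Q j \<omega>\<bar> ^ (2 * k)})"
    by (rule expectation_exp_minus_layer) (use assms in auto)
  also have "\<dots> = pareto_deficit \<beta> b (\<gamma> ^ (2 * k))"
    unfolding pareto_deficit_def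
    \<comment> \<open>The one level at which the tail formula is silent is a null set.\<close>
    by (rule integral_discrete_difference[where X="{b * \<gamma> ^ (2 * k)}"])
       (use assms False in \<open>auto simp: pareto_power_tail[OF P Q] indicator_def\<close>)
  finally show ?thesis by simp
qed

lemma Gamma_has_bochner_integral:
  assumes "s > (0::real)"
  shows "has_bochner_integral lborel (\<lambda>t. indicator {0..} t * t powr (s - 1) / exp t) (Gamma s)"
  by (rule has_bochner_integral_nn_integral)
     (use Gamma_conv_nn_integral_real[OF assms] assms in \<open>auto simp: Gamma_real_pos less_imp_le\<close>)

section \<open>Asymptotics for small jump thresholds\<close>

text \<open>For \<open>z > 0\<close> the rescaled integrand is \<open>exp (- z)\<close> times the
  minimum of \<open>\<epsilon> powr (- \<beta>)\<close> and \<open>(b / z) powr \<beta>\<close>. Its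
  limit \<open>g\<close> also dominates it, and \<open>g\<close> is integrable near 0 because
  \<open>\<beta> < 1\<close>; its integral is a Gamma integral.\<close>

lemma pareto_deficit_limit:
  assumes \<beta>: "0 < \<beta>" "\<beta> < 1" and b: "b \<ge> 0"
  shows "((\<lambda>\<epsilon>. \<epsilon> powr (- \<beta>) * pareto_deficit \<beta> b \<epsilon>) \<longlongrightarrow> b powr \<beta> * Gamma (1 - \<beta>)) (at_right 0)"
\<comment> \<open>Passing to sequences allows dominated convergence; 1 is an arbitrary upper bound
  for their terms.\<close>
proof (rule tendsto_at_right_sequentially[of _ 1])
  fix S :: "nat \<Rightarrow> real"
  assume S: "\<And>n. 0 < S n" "S \<longlonglongrightarrow> 0"
  define g where "g z = indicator {0<..} z * exp (- z) * (b / z) powr \<beta>" for z :: real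
  define d where "d n z = S n powr (- \<beta>) * (indicator {0<..} z * exp (- z) * min 1 ((b * S n / z) powr \<beta>))"
    for n and z :: real
  have [measurable]: "g \<in> borel_measurable borel" "d n \<in> borel_measurable borel" for n
    unfolding g_def[abs_def] d_def[abs_def] by measurable
  have "has_bochner_integral lborel (\<lambda>t. b powr \<beta> * (indicator {0..} t * t powr (1 - \<beta> - 1) / exp t))
      (b powr \<beta> * Gamma (1 - \<beta>))"
    using Gamma_has_bochner_integral[of "1 - \<beta>"] \<beta> by (intro has_bochner_integral_mult_right) simp
  \<comment> \<open>The indicators differ at 0, but there \<open>0 powr (- \<beta>)\<close> is 0 by
    convention.\<close>
  also have "(\<lambda>t. b powr \<beta> * (indicator {0..} t * t powr (1 - \<beta> - 1) / exp t)) = g"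
    using b by (auto simp: g_def fun_eq_iff indicator_def powr_divide powr_minus exp_minus field_simps)
  finally have g: "integrable lborel g" "integral\<^sup>L lborel g = b powr \<beta> * Gamma (1 - \<beta>)"
    by (auto simp: has_bochner_integral_iff)
  have scale: "S n powr (- \<beta>) * (b * S n / z) powr \<beta> = (b / z) powr \<beta>" if "z > 0" for n z
  proof -
    have "(b * S n / z) powr \<beta> = (b / z) powr \<beta> * S n powr \<beta>"
      using S(1)[of n] b that by (simp flip: powr_mult)
    then show ?thesis using S(1)[of n] by (simp add: powr_minus)
  qed
  have "(\<lambda>n. integral\<^sup>L lborel (d n)) \<longlonglongrightarrow> integral\<^sup>L lborel g"
  proof (rule integral_dominated_convergence[where w=g])
    show "AE z in lborel. (\<lambda>n. d n z) \<longlonglongrightarrow> g z"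
    proof (rule AE_I2)
      fix z :: real
      show "(\<lambda>n. d n z) \<longlonglongrightarrow> g z"
      proof (cases "z > 0")
        case True
        have "(\<lambda>n. (b * S n / z) powr \<beta>) \<longlonglongrightarrow> (b * 0 / z) powr \<beta>"
          by (intro tendsto_powr' tendsto_intros S)
             (use \<beta> b S True in \<open>auto intro!: always_eventually simp: less_imp_le\<close>)
        \<comment> \<open>From here on the minimum is the power, so \<open>d n z\<close> is not
          merely close to \<open>g z\<close> but equal to it.\<close>
        then have "eventually (\<lambda>n. (b * S n / z) powr \<beta> < 1) sequentially"
          by (rule order_tendstoD(2)) simp
        then have "eventually (\<lambda>n. d n z = g z) sequentially"
          by eventually_elim (use True scale[OF True] in \<open>simp add: d_def g_def mult_ac\<close>)
        then show ?thesis by (rule tendsto_eventually)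
      qed (simp add: d_def g_def)
    qed
    show "AE z in lborel. norm (d n z) \<le> g z" for n
    proof (rule AE_I2)
      fix z :: real
      show "norm (d n z) \<le> g z"
      proof (cases "z > 0")
        case True
        have "norm (d n z) = exp (- z) * (S n powr (- \<beta>) * min 1 ((b * S n / z) powr \<beta>))"
          using True by (simp add: d_def abs_mult)
        also have "\<dots> \<le> exp (- z) * (S n powr (- \<beta>) * (b * S n / z) powr \<beta>)"
          by (intro mult_left_mono) auto
        also have "\<dots> = g z" using True by (simp add: scale g_def)
        finally show ?thesis .
      qed (simp add: d_def g_def)
    qed
  qed (use g in auto)
  then show "(\<lambda>n. S n powr (- \<beta>) * pareto_deficit \<beta> b (S n)) \<longlonglongrightarrow> b powr \<beta> * Gamma (1 - \<beta>)"
    by (simp add: d_def[abs_def] g(2) pareto_deficit_def)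
qed simp


section \<open>Poisson sums\<close>

text \<open>The \<sigma>-algebras generated by \<open>X\<close> and \<open>Y\<close> lie inside
  \<open>A\<close> and \<open>B\<close>, and independence is inherited by smaller
  \<sigma>-algebras.\<close>

lemma (in prob_space) indep_set_imp_indep_var:
  assumes ind: "indep_set (sets A) (sets B)" and sp: "space A = space M" "space B = space M"
    and X: "X \<in> measurable A S" and Y: "Y \<in> measurable B T"
  shows "indep_var S X T Y"
proof -
  have AB: "sets A \<subseteq> events" "sets B \<subseteq> events"
    "\<And>a b. a \<in> sets A \<Longrightarrow> b \<in> sets B \<Longrightarrow> prob (a \<inter> b) = prob a * prob b"
    using ind by (auto simp: indep_sets2_eq)
  have 1: "sigma_sets (space M) {X -` C \<inter> space M |C. C \<in> sets S} \<subseteq> sets A"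
    using sets.sigma_sets_subset[of "{X -` C \<inter> space M |C. C \<in> sets S}" A] measurable_sets[OF X] sp
    by auto
  have 2: "sigma_sets (space M) {Y -` C \<inter> space M |C. C \<in> sets T} \<subseteq> sets B"
    using sets.sigma_sets_subset[of "{Y -` C \<inter> space M |C. C \<in> sets T}" B] measurable_sets[OF Y] sp
    by auto
  have "random_variable S X" "random_variable T Y"
    using measurable_space[OF X] measurable_sets[OF X] measurable_space[OF Y] measurable_sets[OF Y] AB sp
    by (auto intro!: measurableI)
  then show ?thesis
    unfolding indep_var_eq indep_sets2_eq using 1 2 AB by blast
qed

lemma poisson_process_measurable:
  "poisson_process P r N \<Longrightarrow> T \<ge> 0 \<Longrightarrow> N T \<in> measurable P (count_space UNIV)"
  by (simp add: poisson_process_def increasing_indep_increments_def)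

text \<open>The Poisson law is prescribed for increments; the increment from time 0 is almost surely
  \<open>N T\<close> itself.\<close>

lemma poisson_process_prob:
  assumes N: "poisson_process P r N" and r: "r > 0" and T: "T > 0"
  shows "measure P {\<omega> \<in> space P. N T \<omega> = n} = (r * T) ^ n / fact n * exp (- (r * T))"
proof -
  have [measurable]: "N T \<in> measurable P (count_space UNIV)" "N 0 \<in> measurable P (count_space UNIV)"
    using poisson_process_measurable[OF N] T by auto
  have "AE \<omega> in P. N 0 \<omega> = 0"
    using N by (simp add: poisson_process_def increasing_indep_increments_def)
  then have "measure P {\<omega> \<in> space P. N T \<omega> = n} = measure P {\<omega> \<in> space P. N T \<omega> - N 0 \<omega> = n}"
    by (intro measure_eq_AE) auto
  also have "\<dots> = measure (distr P (count_space UNIV) (\<lambda>\<omega>. N T \<omega> - N 0 \<omega>)) {n}"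
    by (subst measure_distr) (auto intro!: arg_cong[where f="measure P"])
  also have "\<dots> = pmf (poisson_pmf (r * T)) n"
    using N T by (simp add: poisson_process_def measure_pmf_single)
  finally show ?thesis using r T by simp
qed

text \<open>Split according to the value of \<open>K\<close>; by independence each term factorises,
  and the terms form an exponential series in \<open>r * \<phi>\<close>.\<close>

lemma (in prob_space) expectation_random_prod:
  assumes K[measurable]: "random_variable (count_space UNIV) K" and r: "r \<ge> 0"
    and K_prob: "\<And>n. prob {\<omega> \<in> space M. K \<omega> = n} = r ^ n / fact n * exp (- r)"
    and Y01: "\<And>j \<omega>. \<omega> \<in> space M \<Longrightarrow> 0 \<le> Y j \<omega>" "\<And>j \<omega>. \<omega> \<in> space M \<Longrightarrow> Y j \<omega> \<le> (1::real)"
    and Y_indep: "indep_vars (\<lambda>_. borel) Y UNIV"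
    and Y_exp: "\<And>j. expectation (Y j) = \<phi>"
    and KY_indep: "\<And>n. indep_var borel (\<lambda>\<omega>. indicator {n} (K \<omega>)) borel (\<lambda>\<omega>. \<Prod>j\<le>n. Y j \<omega>)"
  shows "expectation (\<lambda>\<omega>. \<Prod>j\<le>K \<omega>. Y j \<omega>) = \<phi> * exp (- (r * (1 - \<phi>)))"
proof -
  have [measurable]: "Y j \<in> borel_measurable M" for j
    using Y_indep by (auto simp: indep_vars_def)
  define f :: "nat \<Rightarrow> 'a \<Rightarrow> real" where "f n \<omega> = indicator {n} (K \<omega>) * (\<Prod>j\<le>n. Y j \<omega>)" for n \<omega>
  have prod01: "0 \<le> (\<Prod>j\<le>n. Y j \<omega>)" "(\<Prod>j\<le>n. Y j \<omega>) \<le> 1" if "\<omega> \<in> space M" for n \<omega>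
    using Y01[OF that] by (auto intro!: prod_nonneg prod_le_1)
  have Y_int: "integrable M (Y j)" for j
    by (rule integrable_const_bound[where B=1]) (use Y01 in auto)
  have prod_int: "integrable M (\<lambda>\<omega>. \<Prod>j\<le>n. Y j \<omega>)" for n
    by (rule integrable_const_bound[where B=1]) (use prod01 in auto)
  have [measurable]: "(\<lambda>\<omega>. indicator {n} (K \<omega>) :: real) \<in> borel_measurable M" for n
    by (rule measurable_compose[OF K]) simp
  have ind_int: "integrable M (\<lambda>\<omega>. indicator {n} (K \<omega>) :: real)" for n
    by (rule integrable_const_bound[where B=1]) auto
  \<comment> \<open>The product over \<open>{..n}\<close> has \<open>n + 1\<close> factors; this is
    the origin of the extra factor \<open>\<phi>\<close> in the result.\<close>
  have prod_exp: "expectation (\<lambda>\<omega>. \<Prod>j\<le>n. Y j \<omega>) = \<phi> ^ Suc n" for n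
    by (subst indep_vars_lebesgue_integral)
       (auto simp: Y_exp Y_int intro: indep_vars_subset[OF Y_indep])
  have ind_exp: "expectation (\<lambda>\<omega>. indicator {n} (K \<omega>)) = r ^ n / fact n * exp (- r)" for n
  proof -
    have "expectation (\<lambda>\<omega>. indicator {n} (K \<omega>)) =
        (LINT \<omega>|M. (indicator {\<omega> \<in> space M. K \<omega> = n} \<omega> :: real))"
      by (rule Bochner_Integration.integral_cong) (auto simp: indicator_def)
    then show ?thesis by (simp add: K_prob)
  qed
  have f_exp: "expectation (f n) = \<phi> * exp (- r) * ((r * \<phi>) ^ n /\<^sub>R fact n)" for n
    unfolding f_def
    by (subst indep_var_lebesgue_integral[OF KY_indep ind_int prod_int])
       (simp add: ind_exp prod_exp power_mult_distrib divide_inverse)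
  have f_int: "integrable M (f n)" for n
    unfolding f_def by (rule indep_var_integrable[OF KY_indep ind_int prod_int])
  have series: "(\<lambda>n. \<phi> * exp (- r) * ((r * \<phi>) ^ n /\<^sub>R fact n)) sums (\<phi> * exp (- r) * exp (r * \<phi>))"
    by (intro sums_mult exp_converges)
  \<comment> \<open>The terms are nonnegative, so absolute summability is convergence of the
    exponential series.\<close>
  have f_norm: "(LINT \<omega>|M. norm (f n \<omega>)) = expectation (f n)" for n
    by (rule Bochner_Integration.integral_cong) (auto simp: f_def prod01)
  have fin: "f n \<omega> = 0" if "n \<notin> {K \<omega>}" for n \<omega>
    using that by (auto simp: f_def)
  have "(\<Prod>j\<le>K \<omega>. Y j \<omega>) = (\<Sum>n. f n \<omega>)" for \<omega>
    by (subst suminf_finite[of "{K \<omega>}"]) (auto simp: fin, simp add: f_def)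
  then have "expectation (\<lambda>\<omega>. \<Prod>j\<le>K \<omega>. Y j \<omega>) = (LINT \<omega>|M. (\<Sum>n. f n \<omega>))" by simp
  also have "\<dots> = (\<Sum>n. expectation (f n))"
  proof (rule integral_suminf[OF f_int])
    have "summable (\<lambda>n. norm (f n \<omega>))" for \<omega>
      by (rule summable_finite[of "{K \<omega>}"]) (auto simp: fin)
    then show "AE \<omega> in M. summable (\<lambda>n. norm (f n \<omega>))" by simp
    show "summable (\<lambda>n. LINT \<omega>|M. norm (f n \<omega>))"
      unfolding f_norm f_exp using series by (rule sums_summable)
  qed
  also have "\<dots> = \<phi> * exp (- r) * exp (r * \<phi>)"
    unfolding f_exp using series by (rule sums_unique[symmetric])
  also have "\<dots> = \<phi> * exp (- (r * (1 - \<phi>)))"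
    by (simp add: mult_exp_exp algebra_simps)
  finally show ?thesis .
qed

section \<open>Fourier transform of the random sum\<close>

lemma iid_pseudo_sequence_char:
  assumes U: "iid_pseudo_sequence \<nu> w U f"
  shows "pseudo_char (\<nu> n) (w n) (\<lambda>\<eta>. \<Sum>j\<le>n. U n j \<eta> * c j) \<xi> = (\<Prod>j\<le>n. fourier f (c j * \<xi>))"
proof -
  have "pseudo_prob_space (\<nu> n) (w n)" and d: "\<And>j. j \<le> n \<Longrightarrow> has_signed_density (\<nu> n) (w n) (U n j) f"
    and ind: "pseudo_indep (\<nu> n) (w n) (U n) {..n}"
    using U by (auto simp: iid_pseudo_sequence_def)
  then have w: "integrable (\<nu> n) (w n)" by (simp add: pseudo_prob_space_def)
  have "pseudo_char (\<nu> n) (w n) (\<lambda>\<eta>. \<Sum>j\<le>n. c j * U n j \<eta>) \<xi>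
      = (\<Prod>j\<le>n. pseudo_char (\<nu> n) (w n) (\<lambda>\<eta>. c j * U n j \<eta>) \<xi>)"
    using ind unfolding pseudo_indep_def by blast
  also have "\<dots> = (\<Prod>j\<le>n. fourier f (c j * \<xi>))"
    by (rule prod.cong) (auto intro: pseudo_char_scale d w)
  finally show ?thesis by (simp add: mult.commute)
qed

text \<open>Each variable is measurable for the \<sigma>-algebra generated by the path, respectively
  by the sequence; \<open>T \<ge> 0\<close> makes \<open>T\<close> one of the coordinates of the
  path.\<close>

lemma process_indep_sequence_indep_var:
  assumes P: "prob_space P" and ind: "process_indep_sequence P N Q" and T: "T \<ge> 0"
    and g: "g \<in> borel_measurable borel"
  shows "prob_space.indep_var P borel (\<lambda>\<omega>. indicator {n} (N T \<omega>) :: real)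
    borel (\<lambda>\<omega>. \<Prod>j\<le>n. g (Q j \<omega>) :: real)"
proof -
  interpret prob_space P by fact
  note [measurable] = g
  let ?A = "vimage_algebra (space P) (\<lambda>\<omega>. \<lambda>t\<in>{0..}. N t \<omega>) (\<Pi>\<^sub>M t\<in>{0..}. count_space UNIV)"
  let ?B = "vimage_algebra (space P) (\<lambda>\<omega> j. Q j \<omega>) (\<Pi>\<^sub>M j\<in>UNIV. borel)"
  show ?thesis
  proof (rule indep_set_imp_indep_var)
    show "indep_set (sets ?A) (sets ?B)"
      using ind by (simp add: process_indep_sequence_def)
    have "(\<lambda>\<omega>. \<lambda>t\<in>{0..}. N t \<omega>) \<in> measurable ?A (\<Pi>\<^sub>M t\<in>{0..}. count_space UNIV)"
      by (rule measurable_vimage_algebra1) (auto simp: space_PiM)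
    from measurable_compose[OF this measurable_component_singleton[of T]] T
    have "N T \<in> measurable ?A (count_space UNIV)" by simp
    then show "(\<lambda>\<omega>. indicator {n} (N T \<omega>) :: real) \<in> borel_measurable ?A"
      by (rule measurable_compose) simp
    have "(\<lambda>\<omega> j. Q j \<omega>) \<in> measurable ?B (\<Pi>\<^sub>M j\<in>UNIV. borel)"
      by (rule measurable_vimage_algebra1) (auto simp: space_PiM)
    from measurable_compose[OF this measurable_component_singleton]
    have [measurable]: "Q j \<in> borel_measurable ?B" for j by simp
    show "(\<lambda>\<omega>. \<Prod>j\<le>n. g (Q j \<omega>)) \<in> borel_measurable ?B" by measurable
  qed auto
qed

text \<open>Given the genuine variables, the pseudo expectation is a product of factors
  \<open>g (Q j)\<close> in the unit interval; averaging it is the random product formula with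
  Poisson mean \<open>r * T\<close>.\<close>

lemma random_sum_char_eq:
  fixes \<xi> :: real and k :: nat
  defines "b \<equiv> \<bar>\<xi>\<bar> ^ (2 * k)"
  assumes u: "fundamental_solution k u" and U: "iid_pseudo_sequence \<nu> w U (\<lambda>x. u x 1)"
    and P: "prob_space P" and N: "poisson_process P r N" and Q: "iid_pareto P \<gamma> (2 * real k * \<beta>) Q"
    and NQ: "process_indep_sequence P N Q"
    and pos: "\<gamma> > 0" "k \<ge> 1" "\<beta> > 0" "r > 0" "T > 0"
  shows "random_sum_char P \<nu> w U (N T) Q \<xi> =
    of_real ((1 - pareto_deficit \<beta> b (\<gamma> ^ (2 * k))) * exp (- (r * T * pareto_deficit \<beta> b (\<gamma> ^ (2 * k)))))"
proof -
  interpret prob_space P by fact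
  define g where "g q = exp (- (b * \<bar>q\<bar> ^ (2 * k)))" for q :: real
  have g[measurable]: "g \<in> borel_measurable borel" unfolding g_def[abs_def] by measurable
  have b0: "b \<ge> 0" by (simp add: b_def)
  have Q_indep: "indep_vars (\<lambda>_. borel) Q UNIV" using Q by (simp add: iid_pareto_def)
  have "fourier (\<lambda>x. u x 1) (q * \<xi>) = of_real (g q)" for q
    using fundamental_solution_fourier[OF u, of 1 "q * \<xi>"]
    by (simp add: g_def b_def abs_mult power_mult_distrib mult.commute)
  then have "random_sum_char P \<nu> w U (N T) Q \<xi> = of_real (expectation (\<lambda>\<omega>. \<Prod>j\<le>N T \<omega>. g (Q j \<omega>)))"
    unfolding random_sum_char_def iid_pseudo_sequence_char[OF U]
    by (simp add: integral_complex_of_real del: of_real_prod flip: of_real_prod)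
  also have "expectation (\<lambda>\<omega>. \<Prod>j\<le>N T \<omega>. g (Q j \<omega>)) = (1 - pareto_deficit \<beta> b (\<gamma> ^ (2 * k))) *
      exp (- (r * T * (1 - (1 - pareto_deficit \<beta> b (\<gamma> ^ (2 * k))))))"
  proof (rule expectation_random_prod)
    show "random_variable (count_space UNIV) (N T)"
      using poisson_process_measurable[OF N] pos by simp
    show "prob {\<omega> \<in> space P. N T \<omega> = n} = (r * T) ^ n / fact n * exp (- (r * T))" for n
      by (rule poisson_process_prob[OF N]) (use pos in auto)
    show "indep_vars (\<lambda>_. borel) (\<lambda>j \<omega>. g (Q j \<omega>)) UNIV"
      by (rule indep_vars_compose2[OF Q_indep]) simp
    show "expectation (\<lambda>\<omega>. g (Q j \<omega>)) = 1 - pareto_deficit \<beta> b (\<gamma> ^ (2 * k))" for j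
      unfolding g_def by (rule expectation_exp_pareto[OF P Q]) (use pos b0 in auto)
    show "indep_var borel (\<lambda>\<omega>. indicator {n} (N T \<omega>)) borel (\<lambda>\<omega>. \<Prod>j\<le>n. g (Q j \<omega>))" for n
      by (rule process_indep_sequence_indep_var[OF P NQ _ g]) (use pos in simp)
  qed (use pos b0 in \<open>auto simp: g_def\<close>)
  finally show ?thesis by simp
qed

section \<open>Letting the jump threshold tend to zero\<close>

theorem theorem3p3:
  fixes \<beta> t :: real and k :: nat
    and u h :: "real \<Rightarrow> real \<Rightarrow> real"
    and P :: "'a measure" and N :: "real \<Rightarrow> 'a \<Rightarrow> nat" and Q :: "real \<Rightarrow> nat \<Rightarrow> 'a \<Rightarrow> real"
    and \<nu> :: "nat \<Rightarrow> 'b measure" and w :: "nat \<Rightarrow> 'b \<Rightarrow> real" and U :: "nat \<Rightarrow> nat \<Rightarrow> 'b \<Rightarrow> real"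
    and P' :: "'c measure" and H :: "real \<Rightarrow> 'c \<Rightarrow> real"
  assumes "0 < \<beta>" "\<beta> < 1" "k \<ge> 1" "t > 0"
    and "fundamental_solution k u"
    and "iid_pseudo_sequence \<nu> w U (\<lambda>x. u x 1)"
    and "prob_space P"
    and "poisson_process P (1 / Gamma (1 - \<beta>)) N"
    and "\<And>\<gamma>. \<gamma> > 0 \<Longrightarrow> iid_pareto P \<gamma> (2 * real k * \<beta>) (Q \<gamma>)"
    and "\<And>\<gamma>. \<gamma> > 0 \<Longrightarrow> process_indep_sequence P N (Q \<gamma>)"
    and "prob_space P'"
    and "stable_subordinator P' \<beta> H h"
  shows "\<forall>\<xi>. ((\<lambda>\<gamma>. random_sum_char P \<nu> w U (N (t * \<gamma> powr (- 2 * real k * \<beta>))) (Q \<gamma>) \<xi>)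
            \<longlongrightarrow> fourier (subordinated_density u h t) \<xi>) (at_right 0)"
proof
  fix \<xi> :: real
  define b where "b = \<bar>\<xi>\<bar> ^ (2 * k)"
  define D where "D = pareto_deficit \<beta> b"
  define r where "r = 1 / Gamma (1 - \<beta>)"
  have G: "Gamma (1 - \<beta>) > 0" using assms(2) by (simp add: Gamma_real_pos)
  then have r: "r > 0" by (simp add: r_def)
  have b: "b \<ge> 0" by (simp add: b_def)
  have lim: "((\<lambda>\<epsilon>. \<epsilon> powr (- \<beta>) * D \<epsilon>) \<longlongrightarrow> b powr \<beta> * Gamma (1 - \<beta>)) (at_right 0)"
    unfolding D_def by (rule pareto_deficit_limit) (use assms b in auto)
  \<comment> \<open>The deficit is \<open>\<epsilon> powr \<beta>\<close>, which tends to 0, times a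
    convergent quantity. Hence the factor \<open>1 - D \<epsilon>\<close>, due to the summand in
    excess of the Poisson count, tends to 1.\<close>
  have "((\<lambda>\<epsilon>::real. \<epsilon> powr \<beta>) \<longlongrightarrow> 0 powr \<beta>) (at_right 0)"
    using assms(1) by (intro tendsto_powr' tendsto_intros) (auto simp: eventually_at_filter)
  from tendsto_mult[OF this lim]
  have "((\<lambda>\<epsilon>. \<epsilon> powr \<beta> * (\<epsilon> powr (- \<beta>) * D \<epsilon>)) \<longlongrightarrow> 0) (at_right 0)" by simp
  moreover have "eventually (\<lambda>\<epsilon>::real. \<epsilon> powr \<beta> * (\<epsilon> powr (- \<beta>) * D \<epsilon>) = D \<epsilon>) (at_right 0)"
    using eventually_at_right_less[of 0] by eventually_elim (simp add: powr_minus)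
  ultimately have D0: "(D \<longlongrightarrow> 0) (at_right 0)"
    by (rule Lim_transform_eventually)
  have "((\<lambda>\<epsilon>. (1 - D \<epsilon>) * exp (- (r * t * (\<epsilon> powr (- \<beta>) * D \<epsilon>))))
      \<longlongrightarrow> (1 - 0) * exp (- (r * t * (b powr \<beta> * Gamma (1 - \<beta>))))) (at_right 0)"
    by (intro tendsto_intros lim D0)
  then have main: "((\<lambda>\<epsilon>. (1 - D \<epsilon>) * exp (- (r * t * (\<epsilon> powr (- \<beta>) * D \<epsilon>))))
      \<longlongrightarrow> exp (- t * b powr \<beta>)) (at_right 0)"
    \<comment> \<open>The rate \<open>1 / Gamma (1 - \<beta>)\<close> cancels the Gamma factor of
      the limit.\<close>
    using G by (simp add: r_def field_simps)
  \<comment> \<open>The limit in \<open>\<epsilon>\<close> is transported along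
    \<open>\<epsilon> = \<gamma> ^ (2 * k)\<close>, which approaches 0 from the right.\<close>
  have sub: "filterlim (\<lambda>\<gamma>::real. \<gamma> ^ (2 * k)) (at_right 0) (at_right 0)"
  proof -
    have "((\<lambda>\<gamma>::real. \<gamma> ^ (2 * k)) \<longlongrightarrow> 0 ^ (2 * k)) (at_right 0)" by (intro tendsto_intros)
    then have "((\<lambda>\<gamma>::real. \<gamma> ^ (2 * k)) \<longlongrightarrow> 0) (at_right 0)" using assms(3) by (simp add: power_0_left)
    moreover have "eventually (\<lambda>\<gamma>::real. \<gamma> ^ (2 * k) > 0) (at_right 0)"
      using eventually_at_right_less[of 0] by eventually_elim simp
    ultimately show ?thesis by (rule tendsto_imp_filterlim_at_right)
  qed
  have "((\<lambda>\<gamma>. complex_of_real ((1 - D (\<gamma> ^ (2 * k))) *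
      exp (- (r * t * ((\<gamma> ^ (2 * k)) powr (- \<beta>) * D (\<gamma> ^ (2 * k)))))))
      \<longlongrightarrow> of_real (exp (- t * b powr \<beta>))) (at_right 0)"
    by (intro tendsto_of_real filterlim_compose[OF main sub])
  moreover have "eventually (\<lambda>\<gamma>. complex_of_real ((1 - D (\<gamma> ^ (2 * k))) *
      exp (- (r * t * ((\<gamma> ^ (2 * k)) powr (- \<beta>) * D (\<gamma> ^ (2 * k))))))
      = random_sum_char P \<nu> w U (N (t * \<gamma> powr (- 2 * real k * \<beta>))) (Q \<gamma>) \<xi>) (at_right 0)"
    using eventually_at_right_less[of 0]
  proof eventually_elim
    case (elim \<gamma>)
    have "(\<gamma> ^ (2 * k)) powr (- \<beta>) = \<gamma> powr (- 2 * real k * \<beta>)"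
      using elim by (subst powr_realpow[symmetric]) (simp_all add: powr_powr)
    then show ?case
      using random_sum_char_eq[OF assms(5,6,7) assms(8)[folded r_def] assms(9)[OF elim] assms(10)[OF elim],
          of "t * \<gamma> powr (- 2 * real k * \<beta>)" \<xi>] elim assms(1,3,4) r
      by (simp add: D_def b_def mult_ac)
  qed
  ultimately have "((\<lambda>\<gamma>. random_sum_char P \<nu> w U (N (t * \<gamma> powr (- 2 * real k * \<beta>))) (Q \<gamma>) \<xi>)
      \<longlongrightarrow> of_real (exp (- t * b powr \<beta>))) (at_right 0)"
    by (rule Lim_transform_eventually)
  then show "((\<lambda>\<gamma>. random_sum_char P \<nu> w U (N (t * \<gamma> powr (- 2 * real k * \<beta>))) (Q \<gamma>) \<xi>)
      \<longlongrightarrow> fourier (subordinated_density u h t) \<xi>) (at_right 0)"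
    using fourier_subordinated_density[OF assms(5,3,12,4), of \<xi>] by (simp add: b_def)
qed

end
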